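(* Let $\mathscr{H}$ be a complex Hilbert space, let $X,Y\in\mathbb{B}(\mathscr{H})$, and let $T=\begin{pmatrix} 0 & X\\ Y& 0 \end{pmatrix}\in \mathbb{B}(\mathscr{H}\oplus \mathscr{H})$. Then the following inequalities hold: (i) $$w(T) \geq \max \left\{\frac{\|X\|}4, \frac{\|Y\|}4 \right\}+ \frac14 \left(\frac{\|X+Y^*\|}2+\frac{\|X-Y^*\|}2\right) +\frac12\left| \frac{\|X+Y^*\|}2-\frac{\|X-Y^*\|}2\right|.$$ (ii) $$w^2(T) \geq \max \left\{\frac{\|X^*X+YY^*\|}8, \frac{\|XX^*+Y^*Y\|}8 \right\} +\frac14\left(\frac{\|X+Y^*\|^2}{4}+\frac{\|X-Y^*\|^2}{4} \right) +\frac12 \left| \frac{\|X+Y^*\|^2}{4}-\frac{\|X-Y^*\|^2}{4} \right|.$$ (iii) $$w^2(T) \geq \max \left\{\frac{\|X^*X+YY^*\|}8, \frac{\|XX^*+Y^*Y\|}8 \right\}+\frac1{8}\left(\frac{\|(1-i)X+(1+i)Y^*\|^2}4+\frac{\|(1+i)X+(1-i)Y^*\|^2}4 \right)+\frac1{4} \left| \frac{\|(1-i)X+(1+i)Y^*\|^2}4-\frac{\|(1+i)X+(1-i)Y^*\|^2}4 \right|.$$ (iv) $$w^2(T) \leq \max \left\{\frac{\|X^*X+YY^*\|}4, \frac{\|XX^*+Y^*Y\|}4 \right\}+ \frac12 \left| \frac{\|X+Y^*\|^2}{4}+\frac{\|X-Y^*\|^2}{4} \right|.$$ (v) $$w^2(T)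 \leq \max \left\{\frac{\|X^*X+YY^*\|}4, \frac{\|XX^*+Y^*Y\|}4 \right\} +\frac1{4} \left| \frac{\|(1-i)X+(1+i)Y^*\|^2}4+\frac{\|(1+i)X+(1-i)Y^*\|^2}4 \right|.$$
   Context: $\mathbb{B}(\mathscr{H})$ denotes the bounded linear operators on $\mathscr{H}$, $\|\cdot\|$ the operator norm. $\mathscr{H}\oplus\mathscr{H}$ is the Hilbert space direct sum, and $T=\begin{pmatrix} 0 & X\\ Y& 0 \end{pmatrix}$ acts by $T\begin{pmatrix} x\\ y\end{pmatrix}=\begin{pmatrix} Xy\\ Yx\end{pmatrix}$. The numerical radius of an operator $T$ on a Hilbert space $\mathscr{K}$ is $w(T)=\sup\{|\langle Tx,x\rangle| : x\in\mathscr{K},\ \|x\|=1\}$, and $w^2(T)=(w(T))^2$. *)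

theory Defs
  imports "HOL-Analysis.Analysis"
begin

class complex_vector = real_vector +
  fixes scaleC :: "complex \<Rightarrow> 'a \<Rightarrow> 'a" (infixr "*\<^sub>C" 75)
  assumes scaleC_add_right: "a *\<^sub>C (x + y) = a *\<^sub>C x + a *\<^sub>C y"
    and scaleC_add_left: "(a + b) *\<^sub>C x = a *\<^sub>C x + b *\<^sub>C x"
    and scaleC_scaleC: "a *\<^sub>C (b *\<^sub>C x) = (a * b) *\<^sub>C x"
    and scaleC_one: "1 *\<^sub>C x = x"
    and scaleR_scaleC: "r *\<^sub>R x = complex_of_real r *\<^sub>C x"

text \<open>The inner product is linear in the first argument.\<close>

class complex_inner = complex_vector + real_normed_vector +
  fixes cinner :: "'a \<Rightarrow> 'a \<Rightarrow> complex"
  assumes cinner_commute: "cinner x y = cnj (cinner y x)"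
    and cinner_add_left: "cinner (x + y) z = cinner x z + cinner y z"
    and cinner_scaleC_left: "cinner (a *\<^sub>C x) y = a * cinner x y"
    and cinner_ge_zero: "0 \<le> Re (cinner x x)"
    and cinner_eq_zero_iff: "cinner x x = 0 \<longleftrightarrow> x = 0"
    and norm_eq_sqrt_cinner: "norm x = sqrt (Re (cinner x x))"

class chilbert_space = complex_inner + banach

instantiation complex :: chilbert_space
begin

definition scaleC_complex :: "complex \<Rightarrow> complex \<Rightarrow> complex" where
  "scaleC_complex a x = a * x"

definition cinner_complex :: "complex \<Rightarrow> complex \<Rightarrow> complex" where
  "cinner_complex x y = x * cnj y"

instance
proof
  fix x :: complex
  show "norm x = sqrt (Re (cinner x x))"
    by (simp add: cinner_complex_def cmod_def power2_eq_square)
qed (auto simp: scaleC_complex_def cinner_complex_def algebra_simps scaleR_conv_of_real)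

end

text \<open>The Hilbert space direct sum: the library's norm on pairs is
  \<open>norm (x, y) = sqrt ((norm x)\<^sup>2 + (norm y)\<^sup>2)\<close>, which is the norm induced by
  the inner product below.\<close>

instantiation prod :: (complex_vector, complex_vector) complex_vector
begin

definition scaleC_prod :: "complex \<Rightarrow> 'a \<times> 'b \<Rightarrow> 'a \<times> 'b" where
  "scaleC_prod a p = (a *\<^sub>C fst p, a *\<^sub>C snd p)"

instance
  by standard
    (auto simp: scaleC_prod_def scaleR_prod_def scaleR_scaleC scaleC_add_right scaleC_add_left
      scaleC_scaleC scaleC_one)

end

instantiation prod :: (complex_inner, complex_inner) complex_inner
begin

definition cinner_prod :: "'a \<times> 'b \<Rightarrow> 'a \<times> 'b \<Rightarrow> complex" where
  "cinner_prod p q = cinner (fst p) (fst q) + cinner (snd p) (snd q)"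

instance
proof
  fix x y z :: "'a \<times> 'b" and a :: complex
  show "cinner x y = cnj (cinner y x)"
    using cinner_commute[of "fst x" "fst y"] cinner_commute[of "snd x" "snd y"]
    by (simp add: cinner_prod_def)
  show "cinner (x + y) z = cinner x z + cinner y z"
    by (simp add: cinner_prod_def cinner_add_left)
  show "cinner (a *\<^sub>C x) y = a * cinner x y"
    by (simp add: cinner_prod_def scaleC_prod_def cinner_scaleC_left distrib_left)
  show "0 \<le> Re (cinner x x)"
    by (simp add: cinner_prod_def cinner_ge_zero)
  show n: "norm x = sqrt (Re (cinner x x))"
    by (simp add: cinner_prod_def norm_prod_def norm_eq_sqrt_cinner cinner_ge_zero)
  show "cinner x x = 0 \<longleftrightarrow> x = 0"
  proof
    assume "cinner x x = 0"
    then have "norm x = 0" by (simp add: n)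
    then show "x = 0" by simp
  next
    assume "x = 0"
    then show "cinner x x = 0"
      using cinner_eq_zero_iff[of "fst x"] cinner_eq_zero_iff[of "snd x"]
      by (simp add: cinner_prod_def)
  qed
qed

end

instance prod :: (chilbert_space, chilbert_space) chilbert_space ..

definition bounded_clinear :: "('a::complex_inner \<Rightarrow> 'b::complex_inner) \<Rightarrow> bool" where
  "bounded_clinear f \<longleftrightarrow> bounded_linear f \<and> (\<forall>c x. f (c *\<^sub>C x) = c *\<^sub>C f x)"

text \<open>For a bounded operator on a Hilbert space, such a \<open>g\<close> exists by the Riesz representation
  theorem, and it is unique.\<close>

definition cadjoint :: "('a::complex_inner \<Rightarrow> 'b::complex_inner) \<Rightarrow> 'b \<Rightarrow> 'a" where
  "cadjoint f = (SOME g. \<forall>x y. cinner (f x) y = cinner x (g y))"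

text \<open>Inserting \<open>0\<close> only matters on the zero space, which has no unit vectors: the supremum is
  then \<open>0\<close> rather than the unspecified real number \<open>Sup {}\<close>.\<close>

definition numerical_radius :: "('a::complex_inner \<Rightarrow> 'a) \<Rightarrow> real" where
  "numerical_radius T = Sup (insert 0 {cmod (cinner (T x) x) | x. norm x = 1})"

definition offdiag :: "('b \<Rightarrow> 'a) \<Rightarrow> ('a \<Rightarrow> 'b) \<Rightarrow> 'a \<times> 'b \<Rightarrow> 'a \<times> 'b" where
  "offdiag X Y = (\<lambda>(x, y). (X y, Y x))"

end

theory Submission
  imports Defs
begin

text \<open>For a complex number \<open>a\<close> put \<open>S\<^sub>a = a X + cnj a Y\<^sup>*\<close>. The real part of \<open>a T\<close> is off-diagonal
  with entries \<open>S\<^sub>a / 2\<close> and its adjoint, and the real part of \<open>\<i> a T\<close> is, up to sign, the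
  imaginary part of \<open>a T\<close>. Hence, with \<open>p = \<parallel>S\<^sub>a\<parallel> / (2 \<bar>a\<bar>)\<close> and \<open>q = \<parallel>S\<^sub>b\<parallel> / (2 \<bar>a\<bar>)\<close> for
  \<open>b = \<i> a\<close>, both \<open>p\<close> and \<open>q\<close> are at most \<open>w(T)\<close>, and \<open>w(T)\<^sup>2 \<le> p\<^sup>2 + q\<^sup>2\<close>. Write \<open>M\<close> for the
  maximum of \<open>\<parallel>X\<^sup>*X + YY\<^sup>*\<parallel>\<close> and \<open>\<parallel>XX\<^sup>* + Y\<^sup>*Y\<parallel>\<close>. The identity
  \<open>S\<^sub>a\<^sup>*S\<^sub>a + S\<^sub>b\<^sup>*S\<^sub>b = 2 \<bar>a\<bar>\<^sup>2 (X\<^sup>*X + YY\<^sup>*)\<close> gives \<open>M \<le> 2 (p\<^sup>2 + q\<^sup>2)\<close>, and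
  \<open>\<bar>\<langle>Tz,z\<rangle>\<bar>\<^sup>2 \<le> (\<parallel>Tz\<parallel>\<^sup>2 + \<parallel>T\<^sup>*z\<parallel>\<^sup>2) / 2\<close> gives \<open>w(T)\<^sup>2 \<le> M / 2\<close>. The lower bounds follow from
  \<open>max p q = (p + q) / 2 + \<bar>p - q\<bar> / 2\<close> and its analogue for squares, with \<open>\<parallel>X\<parallel>, \<parallel>Y\<parallel> \<le> p + q\<close> for
  \<open>a = 1\<close>; the upper bounds are averages of the two bounds on \<open>w(T)\<^sup>2\<close>. Take \<open>a = 1\<close> in (i), (ii),
  (iv) and \<open>a = 1 - \<i>\<close> in (iii), (v).\<close>

section \<open>Scalar multiplication, inner product and Cauchy-Schwarz\<close>

lemma scaleC_zero_right [simp]: "a *\<^sub>C (0::'a::complex_vector) = 0"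
  using scaleC_add_right[of a "0::'a" 0] by simp

lemma scaleC_zero_left [simp]: "0 *\<^sub>C (x::'a::complex_vector) = 0"
  using scaleC_add_left[of 0 0 x] by simp

lemma scaleC_minus_left: "(- a) *\<^sub>C (x::'a::complex_vector) = - (a *\<^sub>C x)"
  using scaleC_add_left[of "- a" a x] by (simp add: eq_neg_iff_add_eq_0)

lemma scaleC_minus_right: "a *\<^sub>C (- x::'a::complex_vector) = - (a *\<^sub>C x)"
  using scaleC_add_right[of a "- x" x] by (simp add: eq_neg_iff_add_eq_0)

lemma scaleC_diff_right: "a *\<^sub>C (x - y) = a *\<^sub>C x - a *\<^sub>C (y::'a::complex_vector)"
  using scaleC_add_right[of a x "- y"] by (simp add: scaleC_minus_right)

lemma cinner_add_right: "cinner x (y + z) = cinner x y + cinner x z"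
  by (metis cinner_add_left cinner_commute complex_cnj_add)

lemma cinner_scaleC_right: "cinner x (a *\<^sub>C y) = cnj a * cinner x y"
  by (metis cinner_scaleC_left cinner_commute complex_cnj_mult)

lemma cinner_zero_left [simp]: "cinner 0 x = 0"
  using cinner_add_left[of 0 0 x] by simp

lemma cinner_zero_right [simp]: "cinner x 0 = 0"
  using cinner_add_right[of x 0 0] by simp

lemma cinner_minus_left: "cinner (- x) y = - cinner x y"
  using cinner_add_left[of "- x" x y] by (simp add: eq_neg_iff_add_eq_0)

lemma cinner_minus_right: "cinner x (- y) = - cinner x y"
  using cinner_add_right[of x "- y" y] by (simp add: eq_neg_iff_add_eq_0)

lemma cinner_diff_left: "cinner (x - y) z = cinner x z - cinner y z"
  using cinner_add_left[of x "- y" z] by (simp add: cinner_minus_left)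

lemma cinner_diff_right: "cinner x (y - z) = cinner x y - cinner x z"
  using cinner_add_right[of x y "- z"] by (simp add: cinner_minus_right)

lemma cinner_scaleR_left: "cinner (r *\<^sub>R x) y = complex_of_real r * cinner x y"
  by (simp add: scaleR_scaleC cinner_scaleC_left)

lemma cinner_scaleR_right: "cinner x (r *\<^sub>R y) = complex_of_real r * cinner x y"
  by (simp add: scaleR_scaleC cinner_scaleC_right)

lemmas cinner_simps = cinner_add_left cinner_add_right cinner_diff_left cinner_diff_right
  cinner_scaleC_left cinner_scaleC_right cinner_scaleR_left cinner_scaleR_right

lemma Re_cinner_commute: "Re (cinner x y) = Re (cinner y x)"
  by (metis cinner_commute cnj.simps(1))

lemma norm_sq_eq_cinner: "(norm x)\<^sup>2 = Re (cinner x x)"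
  by (simp add: norm_eq_sqrt_cinner cinner_ge_zero)

lemma cinner_self: "cinner x x = complex_of_real ((norm x)\<^sup>2)"
  by (metis cinner_commute norm_sq_eq_cinner Reals_cnj_iff complex_is_Real_iff
      of_real_Re)

lemma norm_scaleC: "norm (a *\<^sub>C x) = cmod a * norm (x::'a::complex_inner)"
proof -
  have "complex_of_real ((norm (a *\<^sub>C x))\<^sup>2) = a * cnj a * complex_of_real ((norm x)\<^sup>2)"
    unfolding cinner_self[symmetric] by (simp add: cinner_simps)
  also have "\<dots> = complex_of_real ((cmod a * norm x)\<^sup>2)"
    by (simp add: complex_norm_square[symmetric] power_mult_distrib)
  finally have "(norm (a *\<^sub>C x))\<^sup>2 = (cmod a * norm x)\<^sup>2"
    using of_real_eq_iff by blast
  then show ?thesis by simp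
qed

lemma cinner_Cauchy_Schwarz: "cmod (cinner x y) \<le> norm x * norm y"
proof (cases "y = 0")
  case False
  define c where "c = cinner x y"
  have cyx: "cinner y x = cnj c"
    unfolding c_def by (rule cinner_commute)
  have cc: "c * cnj c = complex_of_real ((cmod c)\<^sup>2)"
    by (rule complex_norm_square[symmetric])
  \<comment> \<open>The vector is the component of \<open>x\<close> orthogonal to \<open>y\<close>,
    multiplied by \<open>(norm y)\<^sup>2\<close> to avoid a division.\<close>
  have "complex_of_real ((norm ((norm y)\<^sup>2 *\<^sub>R x - c *\<^sub>C y))\<^sup>2) =
      complex_of_real ((norm y)\<^sup>2 * ((norm y)\<^sup>2 * (norm x)\<^sup>2 - (cmod c)\<^sup>2))"
    unfolding cinner_self[symmetric] of_real_mult of_real_diff cc[symmetric]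
    by (simp add: cinner_simps cyx c_def[symmetric])
      (simp add: cinner_self algebra_simps flip: complex_norm_square)
  then have "(norm y)\<^sup>2 * ((norm y)\<^sup>2 * (norm x)\<^sup>2 - (cmod c)\<^sup>2) \<ge> 0"
    by (metis of_real_eq_iff zero_le_power2)
  with False have "(cmod c)\<^sup>2 \<le> (norm x * norm y)\<^sup>2"
    by (simp add: zero_le_mult_iff power_mult_distrib mult.commute)
  then show ?thesis
    unfolding c_def by (simp add: power2_le_iff_abs_le)
qed simp

lemma cinner_eqI:
  assumes "\<And>z. cinner z x = cinner z y"
  shows "x = y"
proof -
  have "cinner (x - y) (x - y) = 0"
    using assms[of "x - y"] by (simp add: cinner_diff_right)
  then show ?thesis by (simp add: cinner_eq_zero_iff)
qed

section \<open>Riesz representation and adjoints\<close>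

lemma bounded_clinear_linear: "bounded_clinear f \<Longrightarrow> bounded_linear f"
  by (simp add: bounded_clinear_def)

lemma bounded_clinear_scaleC: "bounded_clinear f \<Longrightarrow> f (c *\<^sub>C x) = c *\<^sub>C f x"
  by (simp add: bounded_clinear_def)

lemma bounded_linear_scaleC: "bounded_linear (\<lambda>x::'a::complex_inner. c *\<^sub>C x)"
  by (rule bounded_linear_intro[of _ "cmod c"])
    (simp_all add: scaleC_add_right scaleC_scaleC scaleR_scaleC norm_scaleC mult.commute)

text \<open>The representing vector is the minimiser of \<open>\<lambda>x. (norm x)\<^sup>2 - 2 * Re (f x)\<close>; by the
  parallelogram law every minimising sequence is Cauchy.\<close>

lemma riesz_representation:
  fixes f :: "'a::chilbert_space \<Rightarrow> complex"
  assumes "bounded_clinear f"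
  shows "\<exists>t. \<forall>x. f x = cinner x t"
proof -
  interpret bounded_linear f
    using assms by (rule bounded_clinear_linear)
  define J where "J x = (norm x)\<^sup>2 - 2 * Re (f x)" for x
  obtain K where K: "\<And>x. norm (f x) \<le> norm x * K"
    using bounded by blast
  \<comment> \<open>Completing the square: \<open>J x\<close> is at least
    \<open>(norm x - K)\<^sup>2 - K\<^sup>2\<close>.\<close>
  have J_bound: "- K\<^sup>2 \<le> J x" for x
  proof -
    have "Re (f x) \<le> norm x * K"
      using K[of x] complex_Re_le_cmod[of "f x"] by linarith
    moreover have "0 \<le> (norm x - K)\<^sup>2" by simp
    ultimately show ?thesis
      unfolding J_def power2_diff by linarith
  qed
  define m where "m = Inf (range J)"
  have bdd: "bdd_below (range J)"
    using J_bound by (auto intro!: bdd_belowI[of _ "- K\<^sup>2"])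
  have m_le: "m \<le> J x" for x
    unfolding m_def by (rule cInf_lower[OF _ bdd]) simp
  have "\<exists>x. J x < m + 1 / real (Suc n)" for n
    using cInf_lessD[of "range J" "m + 1 / real (Suc n)"] by (auto simp: m_def)
  then obtain u where u: "\<And>n. J (u n) < m + 1 / real (Suc n)"
    by metis
  \<comment> \<open>The terms in \<open>f\<close> cancel by linearity, and only the parallelogram
    law for the norm remains.\<close>
  have par: "(norm (x - y))\<^sup>2 = 2 * J x + 2 * J y - 4 * J ((1/2) *\<^sub>R (x + y))" for x y
    unfolding J_def norm_sq_eq_cinner scaleR add
    by (simp add: cinner_simps Re_cinner_commute[of y x] algebra_simps)
  \<comment> \<open>Both values of \<open>J\<close> are below \<open>m + 1 / real (Suc n)\<close>
    and the midpoint value is at least \<open>m\<close>, whence the constant 4.\<close>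
  have dist_u: "(norm (u i - u j))\<^sup>2 < 4 / real (Suc n)" if "n \<le> i" "n \<le> j" for i j n
  proof -
    have "1 / real (Suc i) \<le> 1 / real (Suc n)" "1 / real (Suc j) \<le> 1 / real (Suc n)"
      using that by (auto intro!: divide_left_mono)
    with u[of i] u[of j] m_le[of "(1/2) *\<^sub>R (u i + u j)"] show ?thesis
      unfolding par by simp
  qed
  have "Cauchy u"
  proof (rule metric_CauchyI)
    fix e :: real assume "0 < e"
    then obtain n where n: "4 / e\<^sup>2 < real (Suc n)"
      by (metis reals_Archimedean2 less_trans lessI of_nat_less_iff)
    then have "4 / real (Suc n) < e\<^sup>2"
      using \<open>0 < e\<close> by (simp add: field_simps)
    then have "dist (u i) (u j) < e" if "n \<le> i" "n \<le> j" for i j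
      using dist_u[OF that] \<open>0 < e\<close> unfolding dist_norm
      by (meson less_eq_real_def less_trans power_less_imp_less_base)
    then show "\<exists>M. \<forall>i\<ge>M. \<forall>j\<ge>M. dist (u i) (u j) < e" by blast
  qed
  then obtain t where t: "u \<longlonglongrightarrow> t"
    using Cauchy_convergent_iff convergent_def by blast
  have "(\<lambda>n. J (u n)) \<longlonglongrightarrow> J t"
    unfolding J_def by (intro tendsto_intros tendsto t)
  moreover have "(\<lambda>n. m + 1 / real (Suc n)) \<longlonglongrightarrow> m + 0"
    by (intro tendsto_intros LIMSEQ_Suc lim_1_over_n)
  ultimately have "J t \<le> m + 0"
    by (rule LIMSEQ_le) (use u in \<open>auto intro: less_imp_le\<close>)
  then have t_min: "J t \<le> J x" for x
    using m_le[of x] by simp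
  have Re_eq: "Re (f h) = Re (cinner h t)" for h
  proof (cases "h = 0")
    case False
    \<comment> \<open>\<open>2 * d\<close> is the derivative of \<open>J\<close> at \<open>t\<close>
      along \<open>h\<close>, and \<open>r\<close> minimises \<open>J\<close> on that line;
      minimality at \<open>t\<close> forces \<open>d = 0\<close>.\<close>
    define d where "d = Re (cinner h t) - Re (f h)"
    define r where "r = - d / (norm h)\<^sup>2"
    have "J (t + r *\<^sub>R h) = J t + 2 * r * d + r\<^sup>2 * (norm h)\<^sup>2"
      unfolding J_def d_def add scaleR norm_sq_eq_cinner
      by (simp add: cinner_simps Re_cinner_commute[of t h] algebra_simps power2_eq_square)
    also have "\<dots> = J t - d\<^sup>2 / (norm h)\<^sup>2"
      using False by (simp add: r_def field_simps power2_eq_square)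
    finally have "d\<^sup>2 / (norm h)\<^sup>2 \<le> 0"
      using t_min[of "t + r *\<^sub>R h"] by simp
    with False have "d = 0"
      by (simp add: divide_le_0_iff)
    then show ?thesis by (simp add: d_def)
  qed (simp add: zero)
  have "f h = cinner h t" for h
  proof (rule complex_eqI)
    \<comment> \<open>Multiplication by \<i> turns an imaginary part into minus a real part, so the
      real-part identity is applied at \<open>\<i> *\<^sub>C h\<close>.\<close>
    have "f (\<i> *\<^sub>C h) = \<i> * f h"
      using assms by (simp add: bounded_clinear_scaleC scaleC_complex_def)
    then show "Im (f h) = Im (cinner h t)"
      using Re_eq[of "\<i> *\<^sub>C h"] by (simp add: cinner_simps)
  qed (rule Re_eq)
  then show ?thesis by blast
qed

text \<open>\<open>cadjoint\<close> is a choice, so existence has to be shown: Riesz applied to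
  \<open>\<lambda>x. cinner (f x) y\<close> for each \<open>y\<close> supplies an admissible
  \<open>g\<close>.\<close>

lemma cinner_cadjoint:
  fixes f :: "'a::chilbert_space \<Rightarrow> 'b::complex_inner"
  assumes f: "bounded_clinear f"
  shows "cinner (f x) y = cinner x (cadjoint f y)"
proof -
  interpret bounded_linear f
    using f by (rule bounded_clinear_linear)
  obtain K where K: "\<And>x. norm (f x) \<le> norm x * K"
    using bounded by blast
  have "\<exists>t. \<forall>x. cinner (f x) y = cinner x t" for y
  proof (rule riesz_representation)
    have "norm (cinner (f x) y) \<le> norm x * (K * norm y)" for x
      using cinner_Cauchy_Schwarz[of "f x" y] mult_right_mono[OF K[of x], of "norm y"]
      by (simp add: mult.assoc)
    then have "bounded_linear (\<lambda>x. cinner (f x) y)"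
      by (intro bounded_linear_intro) (auto simp: add scaleR cinner_simps scaleR_conv_of_real)
    then show "bounded_clinear (\<lambda>x. cinner (f x) y)"
      using f by (auto simp: bounded_clinear_def cinner_simps scaleC_complex_def)
  qed
  then have "\<exists>g. \<forall>x y. cinner (f x) y = cinner x (g y)"
    by metis
  from someI_ex[OF this] show ?thesis
    unfolding cadjoint_def by blast
qed

lemma cinner_cadjoint':
  fixes f :: "'a::chilbert_space \<Rightarrow> 'b::complex_inner"
  assumes "bounded_clinear f"
  shows "cinner (cadjoint f y) x = cinner y (f x)"
  by (metis assms cinner_cadjoint cinner_commute)

text \<open>Testing with \<open>u = x\<close> and cancelling one factor \<open>norm x\<close>
  suffices. This turns bounds on inner products into operator norm bounds.\<close>

lemma norm_le_of_cinner_le: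
  assumes "0 \<le> B" and "\<And>u. cmod (cinner x u) \<le> B * norm u"
  shows "norm x \<le> B"
proof (cases "x = 0")
  case False
  have "norm x * norm x \<le> B * norm x"
    using assms(2)[of x] by (simp add: cinner_self norm_mult power2_eq_square)
  with False show ?thesis
    by (simp add: mult_le_cancel_right)
qed (use assms(1) in simp)

lemma bounded_clinear_cadjoint:
  fixes f :: "'a::chilbert_space \<Rightarrow> 'b::complex_inner"
  assumes f: "bounded_clinear f"
  shows "bounded_clinear (cadjoint f)"
proof -
  obtain K where K: "0 \<le> K" "\<And>x. norm (f x) \<le> norm x * K"
    using bounded_linear.nonneg_bounded[OF bounded_clinear_linear[OF f]] by blast
  have add: "cadjoint f (x + y) = cadjoint f x + cadjoint f y" for x y
    by (rule cinner_eqI) (simp add: cinner_cadjoint[OF f, symmetric] cinner_simps)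
  have scaleC: "cadjoint f (c *\<^sub>C x) = c *\<^sub>C cadjoint f x" for c x
    by (rule cinner_eqI) (simp add: cinner_cadjoint[OF f, symmetric] cinner_simps)
  have "norm (cadjoint f y) \<le> norm y * K" for y
  proof (rule norm_le_of_cinner_le)
    fix u
    have "cmod (cinner (cadjoint f y) u) \<le> norm y * norm (f u)"
      unfolding cinner_cadjoint'[OF f] by (rule cinner_Cauchy_Schwarz)
    also have "\<dots> \<le> norm y * (norm u * K)"
      by (intro mult_left_mono K) simp
    finally show "cmod (cinner (cadjoint f y) u) \<le> norm y * K * norm u"
      by (simp add: ac_simps)
  qed (simp add: K)
  then have "bounded_linear (cadjoint f)"
    by (intro bounded_linear_intro) (auto simp: add scaleC scaleR_scaleC)
  with scaleC show ?thesis
    by (simp add: bounded_clinear_def)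
qed

text \<open>Moving \<open>f\<close> across as \<open>g\<close> and applying Cauchy-Schwarz bounds
  every inner product with \<open>f x\<close>.\<close>

lemma onorm_le_onorm_of_cinner_eq:
  assumes "bounded_linear g" and fg: "\<And>x y. cinner (f x) y = cinner x (g y)"
  shows "onorm f \<le> onorm g"
proof (rule onorm_bound)
  fix x
  show "norm (f x) \<le> onorm g * norm x"
  proof (rule norm_le_of_cinner_le)
    fix u
    have "cmod (cinner (f x) u) \<le> norm x * norm (g u)"
      unfolding fg by (rule cinner_Cauchy_Schwarz)
    also have "\<dots> \<le> norm x * (onorm g * norm u)"
      by (intro mult_left_mono onorm assms) simp
    finally show "cmod (cinner (f x) u) \<le> onorm g * norm x * norm u"
      by (simp add: ac_simps)
  qed (simp add: onorm_pos_le assms)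
qed (simp add: onorm_pos_le assms)

lemma onorm_cong_norm:
  assumes "\<And>x. norm (f x) = norm (g x)"
  shows "onorm f = onorm g"
  unfolding onorm_def using assms by simp

section \<open>The numerical radius\<close>

lemma cinner_le_numerical_radius_unit:
  assumes "bounded_linear T" "norm z = 1"
  shows "cmod (cinner (T z) z) \<le> numerical_radius T"
  unfolding numerical_radius_def
proof (rule cSup_upper)
  show "bdd_above (insert 0 {cmod (cinner (T x) x) |x. norm x = 1})"
  proof (rule bdd_aboveI)
    fix r assume "r \<in> insert 0 {cmod (cinner (T x) x) |x. norm x = 1}"
    then consider "r = 0" | x where "r = cmod (cinner (T x) x)" "norm x = 1"
      by auto
    then show "r \<le> onorm T"
    proof cases
      case 2
      then show ?thesis
        using cinner_Cauchy_Schwarz[of "T x" x] onorm[OF assms(1), of x] by simp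
    qed (simp add: onorm_pos_le assms)
  qed
qed (use assms in auto)

text \<open>Both sides are homogeneous of degree 2, so normalising \<open>z\<close> reduces the
  claim to unit vectors.\<close>

lemma cinner_le_numerical_radius:
  assumes "bounded_linear T"
  shows "cmod (cinner (T z) z) \<le> numerical_radius T * (norm z)\<^sup>2"
proof (cases "z = 0")
  case False
  interpret bounded_linear T by fact
  have "cmod (cinner (T ((1 / norm z) *\<^sub>R z)) ((1 / norm z) *\<^sub>R z)) \<le> numerical_radius T"
    using False by (intro cinner_le_numerical_radius_unit assms) simp
  then show ?thesis
    using False by (simp add: scaleR cinner_simps norm_mult norm_divide field_simps power2_eq_square)
qed simp

lemma numerical_radius_power2_le:
  assumes "0 \<le> B" and "\<And>z. norm z = 1 \<Longrightarrow> (cmod (cinner (T z) z))\<^sup>2 \<le> B"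
  shows "(numerical_radius T)\<^sup>2 \<le> B"
proof -
  have "numerical_radius T \<le> sqrt B"
    unfolding numerical_radius_def
    using assms by (intro cSup_least) (auto intro: real_le_rsqrt)
  \<comment> \<open>Squaring needs a nonnegative supremum. Without unit vectors the set contains
    only 0; otherwise the hypothesis supplies the upper bound that \<open>cSup_upper\<close> asks
    for.\<close>
  moreover have "0 \<le> numerical_radius T"
  proof (cases "\<exists>z::'a. norm z = 1")
    case False
    then show ?thesis
      unfolding numerical_radius_def by simp
  next
    case True
    have "bdd_above (insert 0 {cmod (cinner (T x) x) |x. norm x = 1})"
      using assms(2) by (intro bdd_aboveI[of _ "sqrt B"]) (auto intro: real_le_rsqrt assms(1))
    then show ?thesis
      unfolding numerical_radius_def by (intro cSup_upper) auto
  qed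
  ultimately show ?thesis
    using assms(1) by (metis power_mono real_sqrt_pow2)
qed

lemma numerical_radius_nonneg:
  assumes "bounded_linear T"
  shows "0 \<le> numerical_radius T"
proof (cases "\<exists>z::'a. norm z = 1")
  case True
  then show ?thesis
    using cinner_le_numerical_radius_unit[OF assms] norm_ge_zero order_trans by metis
qed (simp add: numerical_radius_def)

section \<open>Rotated sums and the off-diagonal operator\<close>

text \<open>This is \<open>S\<^sub>a\<close>. The values 1, \<i>, \<open>1 - \<i>\<close> and
  \<open>1 + \<i>\<close> of \<open>a\<close> give, up to a unimodular factor, all four sums in the
  theorem.\<close>

definition rotated_sum ::
  "complex \<Rightarrow> ('b::complex_inner \<Rightarrow> 'a::complex_inner) \<Rightarrow> ('a \<Rightarrow> 'b) \<Rightarrow> 'b \<Rightarrow> 'a" where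
  "rotated_sum a X Y = (\<lambda>x. a *\<^sub>C X x + cnj a *\<^sub>C cadjoint Y x)"

lemma rotated_sum_1: "rotated_sum 1 X Y = (\<lambda>x. X x + cadjoint Y x)"
  by (simp add: rotated_sum_def scaleC_one)

lemma norm_rotated_sum_ii: "norm (rotated_sum \<i> X Y x) = norm (X x - cadjoint Y x)"
proof -
  have "rotated_sum \<i> X Y x = \<i> *\<^sub>C (X x - cadjoint Y x)"
    by (simp add: rotated_sum_def scaleC_minus_left scaleC_diff_right)
  then show ?thesis by (simp add: norm_scaleC)
qed

lemma bounded_linear_offdiag:
  assumes "bounded_linear X" "bounded_linear Y"
  shows "bounded_linear (offdiag X Y)"
  unfolding offdiag_def case_prod_beta
  by (intro bounded_linear_Pair bounded_linear_compose[OF assms(1)]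
      bounded_linear_compose[OF assms(2)] bounded_linear_fst bounded_linear_snd)

lemma bounded_linear_rotated_sum:
  fixes X :: "'b::complex_inner \<Rightarrow> 'a::chilbert_space"
  assumes "bounded_clinear X" "bounded_clinear Y"
  shows "bounded_linear (rotated_sum a X Y)"
  unfolding rotated_sum_def
  by (intro bounded_linear_add bounded_linear_compose[OF bounded_linear_scaleC]
      bounded_clinear_linear bounded_clinear_cadjoint assms)

text \<open>Taking adjoints conjugates the coefficients, so the adjoint of \<open>S\<^sub>a\<close>
  is the same expression with \<open>X\<close> and \<open>Y\<close> exchanged.\<close>

lemma cinner_rotated_sum:
  fixes X :: "'b::chilbert_space \<Rightarrow> 'a::chilbert_space"
  assumes "bounded_clinear X" "bounded_clinear Y"
  shows "cinner (rotated_sum a X Y y) x = cinner y (rotated_sum a Y X x)"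
  using assms
  by (simp add: rotated_sum_def cinner_simps cinner_cadjoint cinner_cadjoint' add.commute)

lemma onorm_rotated_sum_swap:
  fixes X :: "'b::chilbert_space \<Rightarrow> 'a::chilbert_space"
  assumes "bounded_clinear X" "bounded_clinear Y"
  shows "onorm (rotated_sum a X Y) \<le> onorm (rotated_sum a Y X)"
  by (intro onorm_le_onorm_of_cinner_eq bounded_linear_rotated_sum cinner_rotated_sum assms)

text \<open>\<open>cnj a * cinner (cadjoint Y y) x\<close> is the conjugate of
  \<open>a * cinner (Y x) y\<close>, so their real parts agree. This links rotated sums to the
  quadratic form of the operator matrix.\<close>

lemma Re_cinner_rotated_sum:
  fixes X :: "'b::complex_inner \<Rightarrow> 'a::chilbert_space"
  assumes "bounded_clinear Y"
  shows "Re (cinner (rotated_sum a X Y y) x) = Re (a * cinner (offdiag X Y (x, y)) (x, y))"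
proof -
  have "cinner (cadjoint Y y) x = cnj (cinner (Y x) y)"
    by (metis assms cinner_cadjoint' cinner_commute)
  then show ?thesis
    by (simp add: rotated_sum_def offdiag_def cinner_prod_def cinner_simps algebra_simps)
qed

lemma onorm_rotated_sum_le:
  fixes X :: "'b::complex_inner \<Rightarrow> 'a::chilbert_space"
  assumes X: "bounded_clinear X" and Y: "bounded_clinear Y"
  shows "onorm (rotated_sum a X Y) \<le> 2 * cmod a * numerical_radius (offdiag X Y)"
proof -
  let ?S = "rotated_sum a X Y" and ?w = "numerical_radius (offdiag X Y)"
  have T: "bounded_linear (offdiag X Y)"
    by (intro bounded_linear_offdiag bounded_clinear_linear X Y)
  have w: "0 \<le> ?w" by (rule numerical_radius_nonneg[OF T])
  have "norm (?S y) \<le> 2 * cmod a * ?w * norm y" for y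
  proof (cases "?S y = 0")
    case False
    define n m where "n = norm (?S y)" and "m = norm y"
    have n: "0 < n" using False by (simp add: n_def)
    have S0: "?S 0 = 0"
      by (intro linear_0 bounded_linear.linear bounded_linear_rotated_sum X Y)
    have m: "0 < m" using False S0 by (auto simp: m_def)
    \<comment> \<open>\<open>x\<close> points along \<open>?S y\<close> and has the length of
      \<open>y\<close>: Cauchy-Schwarz becomes an equality, and
      \<open>(norm (x, y))\<^sup>2 = 2 * m\<^sup>2\<close> yields the factor 2.\<close>
    define x where "x = (m / n) *\<^sub>R ?S y"
    have x: "norm x = m" using n m by (simp add: x_def n_def)
    have "m * n = Re (cinner (?S y) x)"
      using n by (simp add: x_def cinner_simps cinner_self n_def[symmetric] power2_eq_square)
    also have "\<dots> \<le> cmod a * cmod (cinner (offdiag X Y (x, y)) (x, y))"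
      unfolding Re_cinner_rotated_sum[OF Y] norm_mult[symmetric] by (rule complex_Re_le_cmod)
    also have "\<dots> \<le> cmod a * (?w * (norm (x, y))\<^sup>2)"
      by (intro mult_left_mono cinner_le_numerical_radius T) simp
    also have "(norm (x, y))\<^sup>2 = 2 * m\<^sup>2"
      by (simp add: norm_Pair x m_def)
    finally have "m * n \<le> m * (2 * cmod a * ?w * m)"
      by (simp add: power2_eq_square ac_simps)
    with m show ?thesis
      by (simp add: n_def m_def)
  qed (simp add: w)
  then show ?thesis
    using w by (intro onorm_bound) auto
qed

text \<open>For a value \<open>c\<close> of the quadratic form,
  \<open>Re (\<i> * a * c) = - Im (a * c)\<close>, so the two rotated sums control the two
  coordinates of \<open>a * c\<close>.\<close>

lemma numerical_radius_offdiag_le_rotated_sum: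
  fixes X :: "'b::complex_inner \<Rightarrow> 'a::chilbert_space"
  assumes X: "bounded_clinear X" and Y: "bounded_clinear Y"
    and a: "a \<noteq> 0"
  shows "(numerical_radius (offdiag X Y))\<^sup>2
    \<le> ((onorm (rotated_sum a X Y))\<^sup>2 + (onorm (rotated_sum (\<i> * a) X Y))\<^sup>2) / (4 * (cmod a)\<^sup>2)"
proof (rule numerical_radius_power2_le)
  fix z :: "'a \<times> 'b" assume z: "norm z = 1"
  obtain x y where xy: "z = (x, y)" by fastforce
  define c where "c = cinner (offdiag X Y z) z"
  \<comment> \<open>On unit vectors this makes \<open>norm x * norm y\<close> at most 1/2, which
    becomes the 4 in the denominator after squaring.\<close>
  have "2 * (norm x * norm y) \<le> (norm x)\<^sup>2 + (norm y)\<^sup>2"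
    using sum_squares_bound[of "norm x" "norm y"] by simp
  then have le1: "2 * (norm x * norm y) \<le> 1"
    using z by (simp add: xy norm_Pair)
  have b: "(Re (d * c))\<^sup>2 \<le> (onorm (rotated_sum d X Y))\<^sup>2 / 4" for d
  proof -
    let ?S = "rotated_sum d X Y"
    have S: "bounded_linear ?S"
      by (rule bounded_linear_rotated_sum[OF X Y])
    have "\<bar>Re (d * c)\<bar> \<le> cmod (cinner (?S y) x)"
      unfolding c_def xy Re_cinner_rotated_sum[OF Y, symmetric] by (rule abs_Re_le_cmod)
    also have "\<dots> \<le> norm (?S y) * norm x"
      by (rule cinner_Cauchy_Schwarz)
    also have "\<dots> \<le> onorm ?S * norm y * norm x"
      by (intro mult_right_mono onorm S) simp
    also have "\<dots> = onorm ?S * (norm x * norm y)"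
      by simp
    also have "\<dots> \<le> onorm ?S * (1/2)"
      using le1 by (intro mult_left_mono onorm_pos_le S) simp
    finally have "\<bar>Re (d * c)\<bar>\<^sup>2 \<le> (onorm ?S * (1/2))\<^sup>2"
      by (rule power_mono) simp
    then show ?thesis by (simp add: power_mult_distrib power_divide)
  qed
  have "(cmod a)\<^sup>2 * (cmod c)\<^sup>2 = (Re (a * c))\<^sup>2 + (Re (\<i> * a * c))\<^sup>2"
    by (simp add: power_mult_distrib[symmetric] norm_mult[symmetric] cmod_power2)
      (simp add: power2_eq_square algebra_simps)
  then have "(cmod a)\<^sup>2 * (cmod c)\<^sup>2
      \<le> ((onorm (rotated_sum a X Y))\<^sup>2 + (onorm (rotated_sum (\<i> * a) X Y))\<^sup>2) / 4"
    using b[of a] b[of "\<i> * a"] by simp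
  then show "(cmod (cinner (offdiag X Y z) z))\<^sup>2
    \<le> ((onorm (rotated_sum a X Y))\<^sup>2 + (onorm (rotated_sum (\<i> * a) X Y))\<^sup>2) / (4 * (cmod a)\<^sup>2)"
    using a unfolding c_def by (simp add: field_simps)
qed simp

text \<open>In \<open>S\<^sub>a\<^sup>*S\<^sub>a\<close> the cross terms carry the factors
  \<open>a\<^sup>2\<close> and \<open>(cnj a)\<^sup>2\<close>, which change sign when
  \<open>a\<close> becomes \<open>\<i> * a\<close>; they cancel in the sum.\<close>

lemma onorm_gram_le_rotated_sum:
  fixes X :: "'b::chilbert_space \<Rightarrow> 'a::chilbert_space"
  assumes X: "bounded_clinear X" and Y: "bounded_clinear Y"
    and a: "a \<noteq> 0"
  shows "onorm (\<lambda>x. cadjoint X (X x) + Y (cadjoint Y x))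
    \<le> ((onorm (rotated_sum a X Y))\<^sup>2 + (onorm (rotated_sum (\<i> * a) X Y))\<^sup>2) / (2 * (cmod a)\<^sup>2)"
proof (rule onorm_bound)
  fix x
  let ?P = "cadjoint X (X x) + Y (cadjoint Y x)"
  let ?p = "onorm (rotated_sum a X Y)" and ?q = "onorm (rotated_sum (\<i> * a) X Y)"
  show "norm ?P \<le> (?p\<^sup>2 + ?q\<^sup>2) / (2 * (cmod a)\<^sup>2) * norm x"
  proof (rule norm_le_of_cinner_le)
    fix u
    have S: "cmod (cinner (rotated_sum d X Y x) (rotated_sum d X Y u))
        \<le> (onorm (rotated_sum d X Y))\<^sup>2 * (norm x * norm u)" for d
    proof -
      let ?S = "rotated_sum d X Y"
      have S: "bounded_linear ?S"
        by (rule bounded_linear_rotated_sum[OF X Y])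
      have "cmod (cinner (?S x) (?S u)) \<le> norm (?S x) * norm (?S u)"
        by (rule cinner_Cauchy_Schwarz)
      also have "\<dots> \<le> (onorm ?S * norm x) * (onorm ?S * norm u)"
        by (intro mult_mono onorm S mult_nonneg_nonneg onorm_pos_le) simp_all
      finally show ?thesis by (simp add: power2_eq_square ac_simps)
    qed
    have "2 * (a * cnj a) * cinner ?P u
        = cinner (rotated_sum a X Y x) (rotated_sum a X Y u)
          + cinner (rotated_sum (\<i> * a) X Y x) (rotated_sum (\<i> * a) X Y u)"
      unfolding rotated_sum_def
      by (simp add: cinner_simps cinner_cadjoint'[OF X] cinner_cadjoint[OF Y] algebra_simps)
    then have "cmod (2 * (a * cnj a) * cinner ?P u) \<le> (?p\<^sup>2 + ?q\<^sup>2) * (norm x * norm u)"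
      using S[of a] S[of "\<i> * a"] norm_triangle_ineq order_trans
      by (smt (verit) distrib_right)
    then show "cmod (cinner ?P u) \<le> (?p\<^sup>2 + ?q\<^sup>2) / (2 * (cmod a)\<^sup>2) * norm x * norm u"
      using a by (simp add: norm_mult field_simps power2_eq_square)
  qed simp
qed simp

text \<open>For the off-diagonal operator \<open>T\<close>, \<open>T\<^sup>*T + TT\<^sup>*\<close>
  is block diagonal with blocks \<open>?Q\<close> and \<open>?P\<close>, so on unit vectors its form
  is at most the larger norm.\<close>

lemma numerical_radius_offdiag_le_gram:
  fixes X :: "'b::chilbert_space \<Rightarrow> 'a::chilbert_space"
  assumes X: "bounded_clinear X" and Y: "bounded_clinear Y"
  shows "(numerical_radius (offdiag X Y))\<^sup>2
    \<le> max (onorm (\<lambda>x. cadjoint X (X x) + Y (cadjoint Y x)))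
          (onorm (\<lambda>x. X (cadjoint X x) + cadjoint Y (Y x))) / 2"
    (is "_ \<le> max (onorm ?P) (onorm ?Q) / 2")
proof (rule numerical_radius_power2_le)
  note lin = X[THEN bounded_clinear_linear] Y[THEN bounded_clinear_linear]
    X[THEN bounded_clinear_cadjoint, THEN bounded_clinear_linear]
    Y[THEN bounded_clinear_cadjoint, THEN bounded_clinear_linear]
  have P: "bounded_linear ?P"
    by (rule bounded_linear_add[OF bounded_linear_compose[OF lin(3) lin(1)]
          bounded_linear_compose[OF lin(2) lin(4)]])
  have Q: "bounded_linear ?Q"
    by (rule bounded_linear_add[OF bounded_linear_compose[OF lin(1) lin(3)]
          bounded_linear_compose[OF lin(4) lin(2)]])
  show "0 \<le> max (onorm ?P) (onorm ?Q) / 2"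
    using onorm_pos_le[OF P] by simp
  have quad: "Re (cinner (F v) v) \<le> onorm F * (norm v)\<^sup>2"
    if "bounded_linear F" for F :: "'c::complex_inner \<Rightarrow> 'c" and v
  proof -
    have "Re (cinner (F v) v) \<le> norm (F v) * norm v"
      using complex_Re_le_cmod cinner_Cauchy_Schwarz order_trans by blast
    also have "\<dots> \<le> onorm F * norm v * norm v"
      by (intro mult_right_mono onorm that) simp
    finally show ?thesis by (simp add: power2_eq_square)
  qed
  fix z :: "'a \<times> 'b" assume z: "norm z = 1"
  obtain x y where xy: "z = (x, y)" by fastforce
  have z1: "(norm x)\<^sup>2 + (norm y)\<^sup>2 = 1"
    using z by (simp add: xy norm_Pair)
  \<comment> \<open>The value at \<open>z\<close> of the adjoint operator, whose off-diagonal
    entries are \<open>cadjoint Y\<close> and \<open>cadjoint X\<close>.\<close>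
  define T' where "T' = (cadjoint Y y, cadjoint X x)"
  let ?T = "offdiag X Y z"
  have adj: "cinner ?T z = cinner z T'"
    by (simp add: xy T'_def offdiag_def cinner_prod_def cinner_cadjoint[OF X] cinner_cadjoint[OF Y])
  have "(norm ?T)\<^sup>2 + (norm T')\<^sup>2 = Re (cinner (?P y) y) + Re (cinner (?Q x) x)"
    unfolding norm_sq_eq_cinner
    by (simp add: xy T'_def offdiag_def cinner_prod_def cinner_simps
        cinner_cadjoint[OF X] cinner_cadjoint[OF Y] cinner_cadjoint'[OF X] cinner_cadjoint'[OF Y])
  also have "\<dots> \<le> onorm ?P * (norm y)\<^sup>2 + onorm ?Q * (norm x)\<^sup>2"
    by (intro add_mono quad P Q)
  also have "\<dots> \<le> max (onorm ?P) (onorm ?Q) * (norm y)\<^sup>2 + max (onorm ?P) (onorm ?Q) * (norm x)\<^sup>2"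
    by (intro add_mono mult_right_mono) simp_all
  also have "\<dots> = max (onorm ?P) (onorm ?Q)"
    using z1 by (simp add: distrib_left[symmetric] add.commute)
  finally have sum_le: "(norm ?T)\<^sup>2 + (norm T')\<^sup>2 \<le> max (onorm ?P) (onorm ?Q)" .
  have "cmod (cinner ?T z) \<le> norm ?T"
    using cinner_Cauchy_Schwarz[of ?T z] z by simp
  then have "(cmod (cinner ?T z))\<^sup>2 \<le> (norm ?T)\<^sup>2"
    by (rule power_mono) simp
  moreover have "cmod (cinner ?T z) \<le> norm T'"
    using cinner_Cauchy_Schwarz[of z T'] z by (simp add: adj)
  then have "(cmod (cinner ?T z))\<^sup>2 \<le> (norm T')\<^sup>2"
    by (rule power_mono) simp
  ultimately show "(cmod (cinner ?T z))\<^sup>2 \<le> max (onorm ?P) (onorm ?Q) / 2"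
    using sum_le by linarith
qed

text \<open>\<open>2 X\<close> and \<open>2 Y\<^sup>*\<close> are the sum and the difference of
  \<open>X + Y\<^sup>*\<close> and \<open>X - Y\<^sup>*\<close>; \<open>Y\<close> is reached through
  its adjoint.\<close>

lemma onorm_le_half_rotated_sums:
  fixes X :: "'b::chilbert_space \<Rightarrow> 'a::chilbert_space"
  assumes X: "bounded_clinear X" and Y: "bounded_clinear Y"
  shows "max (onorm X) (onorm Y) \<le> (onorm (rotated_sum 1 X Y) + onorm (rotated_sum \<i> X Y)) / 2"
proof -
  let ?p = "onorm (rotated_sum 1 X Y)" and ?q = "onorm (rotated_sum \<i> X Y)"
  note S = bounded_linear_rotated_sum[OF X Y]
  have half: "norm v \<le> (?p + ?q) / 2 * norm x"
    if "norm (2 *\<^sub>R v) \<le> norm (rotated_sum 1 X Y x) + norm (rotated_sum \<i> X Y x)" for v x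
    using that onorm[OF S[of 1], of x] onorm[OF S[of \<i>], of x]
    by (simp add: field_simps)
  have pq: "0 \<le> (?p + ?q) / 2"
    by (simp add: onorm_pos_le S)
  have "onorm X \<le> (?p + ?q) / 2"
  proof (rule onorm_bound[OF pq], rule half)
    fix x
    have "2 *\<^sub>R X x = (X x + cadjoint Y x) + (X x - cadjoint Y x)"
      by (simp add: scaleR_2)
    then show "norm (2 *\<^sub>R X x) \<le> norm (rotated_sum 1 X Y x) + norm (rotated_sum \<i> X Y x)"
      unfolding rotated_sum_1 norm_rotated_sum_ii by (metis norm_triangle_ineq)
  qed
  moreover have "onorm Y \<le> onorm (cadjoint Y)"
    by (intro onorm_le_onorm_of_cinner_eq cinner_cadjoint Y
        bounded_clinear_linear bounded_clinear_cadjoint)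
  moreover have "onorm (cadjoint Y) \<le> (?p + ?q) / 2"
  proof (rule onorm_bound[OF pq], rule half)
    fix x
    have "2 *\<^sub>R cadjoint Y x = (X x + cadjoint Y x) - (X x - cadjoint Y x)"
      by (simp add: scaleR_2)
    then show "norm (2 *\<^sub>R cadjoint Y x)
        \<le> norm (rotated_sum 1 X Y x) + norm (rotated_sum \<i> X Y x)"
      unfolding rotated_sum_1 norm_rotated_sum_ii by (metis norm_triangle_ineq4)
  qed
  ultimately show ?thesis by simp
qed

text \<open>The second Gram operator is the first with \<open>X\<close> and \<open>Y\<close>
  exchanged; the exchange replaces rotated sums by their adjoints and so does not increase their
  norms.\<close>

lemma max_onorm_gram_le_rotated_sum:
  fixes X :: "'b::chilbert_space \<Rightarrow> 'a::chilbert_space"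
  assumes X: "bounded_clinear X" and Y: "bounded_clinear Y"
    and a: "a \<noteq> 0"
  shows "max (onorm (\<lambda>x. cadjoint X (X x) + Y (cadjoint Y x)))
      (onorm (\<lambda>x. X (cadjoint X x) + cadjoint Y (Y x)))
    \<le> ((onorm (rotated_sum a X Y))\<^sup>2 + (onorm (rotated_sum (\<i> * a) X Y))\<^sup>2) / (2 * (cmod a)\<^sup>2)"
proof (rule max.boundedI)
  have swap: "(onorm (rotated_sum d Y X))\<^sup>2 \<le> (onorm (rotated_sum d X Y))\<^sup>2" for d
    by (intro power_mono onorm_rotated_sum_swap onorm_pos_le bounded_linear_rotated_sum X Y)
  have "onorm (\<lambda>x. X (cadjoint X x) + cadjoint Y (Y x))
      \<le> ((onorm (rotated_sum a Y X))\<^sup>2 + (onorm (rotated_sum (\<i> * a) Y X))\<^sup>2) / (2 * (cmod a)\<^sup>2)"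
    using onorm_gram_le_rotated_sum[OF Y X a] by (simp add: add.commute)
  also have "\<dots> \<le> ((onorm (rotated_sum a X Y))\<^sup>2 + (onorm (rotated_sum (\<i> * a) X Y))\<^sup>2)
      / (2 * (cmod a)\<^sup>2)"
    by (intro divide_right_mono add_mono swap) simp
  finally show "onorm (\<lambda>x. X (cadjoint X x) + cadjoint Y (Y x))
    \<le> ((onorm (rotated_sum a X Y))\<^sup>2 + (onorm (rotated_sum (\<i> * a) X Y))\<^sup>2) / (2 * (cmod a)\<^sup>2)" .
qed (rule onorm_gram_le_rotated_sum[OF X Y a])

section \<open>Combining the bounds\<close>

lemma numerical_radius_offdiag_power2_bounds:
  fixes X :: "'b::chilbert_space \<Rightarrow> 'a::chilbert_space"
  assumes X: "bounded_clinear X" and Y: "bounded_clinear Y"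
    and a: "a \<noteq> 0"
  defines "M \<equiv> max (onorm (\<lambda>x. cadjoint X (X x) + Y (cadjoint Y x)))
      (onorm (\<lambda>x. X (cadjoint X x) + cadjoint Y (Y x)))"
    and "A \<equiv> (onorm (rotated_sum a X Y))\<^sup>2 / (4 * (cmod a)\<^sup>2)"
    and "B \<equiv> (onorm (rotated_sum (\<i> * a) X Y))\<^sup>2 / (4 * (cmod a)\<^sup>2)"
  shows "M / 8 + (A + B) / 4 + \<bar>A - B\<bar> / 2 \<le> (numerical_radius (offdiag X Y))\<^sup>2"
    and "(numerical_radius (offdiag X Y))\<^sup>2 \<le> M / 4 + (A + B) / 2"
proof -
  let ?w = "numerical_radius (offdiag X Y)"
  \<comment> \<open>Stated for every \<open>d\<close> of modulus \<open>cmod a\<close>, so that it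
    serves both \<open>a\<close> and \<open>\<i> * a\<close>.\<close>
  have lower: "(onorm (rotated_sum d X Y))\<^sup>2 / (4 * (cmod a)\<^sup>2) \<le> ?w\<^sup>2" if "cmod d = cmod a" for d
  proof -
    have "(onorm (rotated_sum d X Y))\<^sup>2 \<le> (2 * cmod a * ?w)\<^sup>2"
      using onorm_rotated_sum_le[OF X Y, of d] that
      by (intro power_mono onorm_pos_le bounded_linear_rotated_sum X Y) simp
    then show ?thesis
      using a by (simp add: divide_le_eq power_mult_distrib mult.commute)
  qed
  have "A \<le> ?w\<^sup>2" "B \<le> ?w\<^sup>2"
    unfolding A_def B_def by (rule lower, simp add: norm_mult)+
  moreover have "2 * (A + B)
      = ((onorm (rotated_sum a X Y))\<^sup>2 + (onorm (rotated_sum (\<i> * a) X Y))\<^sup>2) / (2 * (cmod a)\<^sup>2)"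
    using a unfolding A_def B_def by (simp add: field_simps)
  then have "M \<le> 2 * (A + B)"
    using max_onorm_gram_le_rotated_sum[OF X Y a] unfolding M_def by simp
  \<comment> \<open>The left side is twice the maximum of \<open>A\<close> and \<open>B\<close>. As
    \<open>M / 8\<close> is at most \<open>(A + B) / 4\<close>, this maximum dominates the whole
    lower bound.\<close>
  moreover from calculation(1,2) have "A + B + \<bar>A - B\<bar> \<le> 2 * ?w\<^sup>2"
    by (simp add: abs_if)
  ultimately show "M / 8 + (A + B) / 4 + \<bar>A - B\<bar> / 2 \<le> ?w\<^sup>2"
    by argo
  have "?w\<^sup>2 \<le> A + B"
    using numerical_radius_offdiag_le_rotated_sum[OF X Y a]
    unfolding A_def B_def by (simp add: add_divide_distrib)
  moreover have "?w\<^sup>2 \<le> M / 2"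
    unfolding M_def by (rule numerical_radius_offdiag_le_gram[OF X Y])
  ultimately show "?w\<^sup>2 \<le> M / 4 + (A + B) / 2"
    by argo
qed

theorem theorem3p1:
  fixes X Y :: "'a::chilbert_space \<Rightarrow> 'a"
    and T :: "'a \<times> 'a \<Rightarrow> 'a \<times> 'a"
  assumes X: "bounded_clinear X"
    and Y: "bounded_clinear Y"
    and T: "T = offdiag X Y"
  shows
   "(numerical_radius T \<ge>
        max (onorm X / 4) (onorm Y / 4)
        + 1/4 * (onorm (\<lambda>x. X x + cadjoint Y x) / 2 + onorm (\<lambda>x. X x - cadjoint Y x) / 2)
        + 1/2 * \<bar>onorm (\<lambda>x. X x + cadjoint Y x) / 2 - onorm (\<lambda>x. X x - cadjoint Y x) / 2\<bar>)
    \<and>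
    ((numerical_radius T)\<^sup>2 \<ge>
        max (onorm (\<lambda>x. cadjoint X (X x) + Y (cadjoint Y x)) / 8)
            (onorm (\<lambda>x. X (cadjoint X x) + cadjoint Y (Y x)) / 8)
        + 1/4 * ((onorm (\<lambda>x. X x + cadjoint Y x))\<^sup>2 / 4 + (onorm (\<lambda>x. X x - cadjoint Y x))\<^sup>2 / 4)
        + 1/2 * \<bar>(onorm (\<lambda>x. X x + cadjoint Y x))\<^sup>2 / 4 - (onorm (\<lambda>x. X x - cadjoint Y x))\<^sup>2 / 4\<bar>)
    \<and>
    ((numerical_radius T)\<^sup>2 \<ge>
        max (onorm (\<lambda>x. cadjoint X (X x) + Y (cadjoint Y x)) / 8)
            (onorm (\<lambda>x. X (cadjoint X x) + cadjoint Y (Y x)) / 8)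
        + 1/8 * ((onorm (\<lambda>x. (1 - \<i>) *\<^sub>C X x + (1 + \<i>) *\<^sub>C cadjoint Y x))\<^sup>2 / 4
               + (onorm (\<lambda>x. (1 + \<i>) *\<^sub>C X x + (1 - \<i>) *\<^sub>C cadjoint Y x))\<^sup>2 / 4)
        + 1/4 * \<bar>(onorm (\<lambda>x. (1 - \<i>) *\<^sub>C X x + (1 + \<i>) *\<^sub>C cadjoint Y x))\<^sup>2 / 4
               - (onorm (\<lambda>x. (1 + \<i>) *\<^sub>C X x + (1 - \<i>) *\<^sub>C cadjoint Y x))\<^sup>2 / 4\<bar>)
    \<and>
    ((numerical_radius T)\<^sup>2 \<le>
        max (onorm (\<lambda>x. cadjoint X (X x) + Y (cadjoint Y x)) / 4)
            (onorm (\<lambda>x. X (cadjoint X x) + cadjoint Y (Y x)) / 4)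
        + 1/2 * \<bar>(onorm (\<lambda>x. X x + cadjoint Y x))\<^sup>2 / 4 + (onorm (\<lambda>x. X x - cadjoint Y x))\<^sup>2 / 4\<bar>)
    \<and>
    ((numerical_radius T)\<^sup>2 \<le>
        max (onorm (\<lambda>x. cadjoint X (X x) + Y (cadjoint Y x)) / 4)
            (onorm (\<lambda>x. X (cadjoint X x) + cadjoint Y (Y x)) / 4)
        + 1/4 * \<bar>(onorm (\<lambda>x. (1 - \<i>) *\<^sub>C X x + (1 + \<i>) *\<^sub>C cadjoint Y x))\<^sup>2 / 4
               + (onorm (\<lambda>x. (1 + \<i>) *\<^sub>C X x + (1 - \<i>) *\<^sub>C cadjoint Y x))\<^sup>2 / 4\<bar>)"
proof -
  let ?R = "\<lambda>a. onorm (rotated_sum a X Y)"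
  let ?w = "numerical_radius (offdiag X Y)"
  define M where "M = max (onorm (\<lambda>x. cadjoint X (X x) + Y (cadjoint Y x)))
    (onorm (\<lambda>x. X (cadjoint X x) + cadjoint Y (Y x)))"
  define N where "N = max (onorm X) (onorm Y)"
  have plus: "onorm (\<lambda>x. X x + cadjoint Y x) = ?R 1"
    by (simp add: rotated_sum_1)
  have minus: "onorm (\<lambda>x. X x - cadjoint Y x) = ?R \<i>"
    by (rule onorm_cong_norm) (simp add: norm_rotated_sum_ii)
  \<comment> \<open>Here \<open>cnj (1 - \<i>) = 1 + \<i> = \<i> * (1 - \<i>)\<close>.\<close>
  have rot: "(\<lambda>x. (1 - \<i>) *\<^sub>C X x + (1 + \<i>) *\<^sub>C cadjoint Y x) = rotated_sum (1 - \<i>) X Y"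
    "(\<lambda>x. (1 + \<i>) *\<^sub>C X x + (1 - \<i>) *\<^sub>C cadjoint Y x) = rotated_sum (\<i> * (1 - \<i>)) X Y"
    by (simp_all add: rotated_sum_def algebra_simps)
  \<comment> \<open>This doubles the denominators, which is why the coefficients for
    \<open>a = 1 - \<i>\<close> are half of those for \<open>a = 1\<close>.\<close>
  have c: "(cmod (1 - \<i>))\<^sup>2 = 2"
    by (simp add: cmod_power2)
  have max_div: "max (r / c) (s / c) = max r s / c" if "0 < c" for r s c :: real
    using that by (simp add: max_def divide_le_cancel)
  have nz: "1 - \<i> \<noteq> 0"
    by (simp add: complex_eq_iff)
  note bounds1 = numerical_radius_offdiag_power2_bounds[OF X Y, of 1,
      folded M_def, simplified]
  note bounds2 = numerical_radius_offdiag_power2_bounds[OF X Y nz, unfolded c, folded M_def]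
  have "?R 1 / 2 \<le> ?w" "?R \<i> / 2 \<le> ?w"
    using onorm_rotated_sum_le[OF X Y, of 1] onorm_rotated_sum_le[OF X Y, of \<i>] by simp_all
  then have "?R 1 / 2 + ?R \<i> / 2 + \<bar>?R 1 / 2 - ?R \<i> / 2\<bar> \<le> 2 * ?w"
    by (simp add: abs_if)
  \<comment> \<open>\<open>N\<close> is at most \<open>?R 1 / 2 + ?R \<i> / 2\<close>, so the left
    side is at most half of the preceding one.\<close>
  then have i: "N / 4 + 1/4 * (?R 1 / 2 + ?R \<i> / 2) + 1/2 * \<bar>?R 1 / 2 - ?R \<i> / 2\<bar> \<le> ?w"
    using onorm_le_half_rotated_sums[OF X Y, folded N_def] by argo
  have halve: "\<bar>p / (4 * 2) - q / (4 * 2)\<bar> = \<bar>p / 4 - q / 4\<bar> / 2" for p q :: real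
    by (simp add: abs_if)
  have drop_abs: "\<bar>p\<^sup>2 / 4 + q\<^sup>2 / 4\<bar> = p\<^sup>2 / 4 + q\<^sup>2 / 4" for p q :: real
    by simp
  show ?thesis
    unfolding T plus minus rot max_div[OF zero_less_numeral] M_def[symmetric] N_def[symmetric]
      drop_abs
    using i bounds1 bounds2[unfolded halve] by (intro conjI; argo)
qed

end
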